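(* Let $\{\mathbf{u}^n\}_{n=0}^N$ be a sequence of outputs produced by the BDF-2 accelerated gradient flow algorithm in saddle-point form described in the context, where, for a fixed $s>0$, $N:=N(\varepsilon)$ denotes the final iteration number determined by the stopping tolerance $\varepsilon$. When $N\to\infty$ (i.e., $\varepsilon\to0$), there exists $\mathbf{u}^*\in U$ such that $\mathbf{u}^n\rightharpoonup\mathbf{u}^*$ weakly in $U$ up to a subsequence. Moreover, assume in addition that: (i) (inf-sup stability) for any $n\ge0$ there exists a constant $c>0$ with $$\inf_{\mu\in Z^*}\ \sup_{\mathbf{w}\in U_0}\frac{\langle\mu,B(\hat{\mathbf{u}}^n,\mathbf{w})\rangle}{\|\mathbf{w}\|_U\|\mu\|_{Z^*}}\ge c;$$ (ii) $Z\subset Z^{**}$; (iii) $B(\cdot,\mathbf{w}):U\to Z$ is continuous with respect to the weak topology of $U$ for any $\mathbf{w}\in U_0$. Then $\mathbf{u}^*$ is a local minimizer of $E$ in the tangent space $\mathcal{F}_{\mathbf{u}^*}$, i.e. $$E[\mathbf{u}^*]\le E[\mathbf{u}^*+\mathbf{w}]\qquad\text{for all }\mathbf{w}\in\mathcal{F}_{\mathbf{u}^*}.$$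
   Context: Setting. $\Omega\subset\mathbb{R}^d$ is a bounded Lipschitz domain; $U$ is a real Hilbert space of functions $\Omega\to\mathbb{R}^m$ continuously embedded in $H^1(\Omega;\mathbb{R}^m)$; $U_D\subset U$ is the set of functions satisfying given Dirichlet conditions on $\Gamma_D\subset\partial\Omega$ and $U_0\subset U$ is the linear subspace of functions satisfying the corresponding homogeneous conditions. $Z$ is a normed function space on $\Omega$ with dual $Z^*$ and duality pairing $\langle\cdot,\cdot\rangle$ between $Z^*$ and $Z$; $B:U\times U\to Z$ is symmetric bilinear with $\|B(\mathbf{v},\mathbf{v})\|_Z\le c_Z\|\mathbf{v}\|_U^2$, and $\mathbf{u}_c\in Z$. $\mathcal{M}:U\times U\to\mathbb{R}$ is symmetric bilinear with $\mathcal{M}(\mathbf{v},\mathbf{v})\ge C_1\|\mathbf{v}\|_U^2$ and $\mathcal{M}(\mathbf{v},\mathbf{w})\le C_2\|\mathbf{v}\|_U\|\mathbf{w}\|_U$ on $U$ ($C_1,C_2>0$); $E[\mathbf{u}]=\frac12\mathcal{M}(\mathbf{u},\mathbf{u})$. $\mathcal{A}=\{\mathbf{u}\in U_D:B(\mathbf{u},\mathbf{u})=\mathbf{u}_c\text{ a.e. in }\Omega\}$ and $\mathcal{F}_{\mathbf{u}}=\{\mathbf{v}\in U_0:B(\mathbf{u},\mathbf{v})=0\text{ a.e. in }\Omega\}$. $\mathcal{G}_{\mathcal{M}}(\mathbf{u},\mathbf{v})=\frac52\mathcal{M}(\mathbf{u},\mathbf{u})-2\mathcal{M}(\mathbf{u},\mathbf{v})+\frac12\mathcal{M}(\mathbf{v},\mathbf{v})$.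 For a sequence $(a_n)$, $d_ta_n=(a_n-a_{n-1})/s$. Algorithm (BDF-2 accelerated flow, saddle-point form). Input: $\mathbf{u}^0\in\mathcal{A}$, $s>0$, $d_t\mathbf{u}^0=\mathbf{0}$, $\alpha\ge3$, $\varepsilon>0$ and a sufficiently large $T_{max}>0$; put $t_n=ns$. Step 1: with $d_t^2\mathbf{u}^1=(d_t\mathbf{u}^1-d_t\mathbf{u}^0)/s$, find $d_t\mathbf{u}^1\in\mathcal{F}_{\mathbf{u}^0}$ with $(d_t^2\mathbf{u}^1,\mathbf{w})_U+\frac{\alpha}{s}(d_t\mathbf{u}^1,\mathbf{w})_U+\mathcal{M}(\mathbf{u}^0+s\,d_t\mathbf{u}^1,\mathbf{w})=0$ for all $\mathbf{w}\in\mathcal{F}_{\mathbf{u}^0}$; set $\mathbf{u}^1=\mathbf{u}^0+s\,d_t\mathbf{u}^1$. Step 2: with $\hat{\mathbf{u}}^2=2\mathbf{u}^1-\mathbf{u}^0$, find $\dot{\mathbf{u}}^2\in\mathcal{F}_{\hat{\mathbf{u}}^2}$ with $(\frac{\dot{\mathbf{u}}^2-d_t\mathbf{u}^1}{s},\mathbf{w})_U+\frac{\alpha}{2s}(\dot{\mathbf{u}}^2,\mathbf{w})_U+\frac13\mathcal{M}(4\mathbf{u}^1-\mathbf{u}^0+2s\dot{\mathbf{u}}^2,\mathbf{w})=0$ for all $\mathbf{w}\in\mathcal{F}_{\hat{\mathbf{u}}^2}$; set $\mathbf{u}^2=(4\mathbf{u}^1-\mathbf{u}^0+2s\dot{\mathbf{u}}^2)/3$.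 Step $n\ge3$: with $\hat{\mathbf{u}}^n=2\mathbf{u}^{n-1}-\mathbf{u}^{n-2}$, find $(\dot{\mathbf{u}}^n,\lambda^n)\in U_0\times Z^*$ such that for all $(\mathbf{w},\mu)\in U_0\times Z^*$ $$\Big(\tfrac{\dot{\mathbf{u}}^n-\dot{\mathbf{u}}^{n-1}}{s},\mathbf{w}\Big)_U+\tfrac{\alpha}{t_n}(\dot{\mathbf{u}}^n,\mathbf{w})_U+\tfrac13\mathcal{M}(4\mathbf{u}^{n-1}-\mathbf{u}^{n-2}+2s\dot{\mathbf{u}}^n,\mathbf{w})+\langle\lambda^n,B(\hat{\mathbf{u}}^n,\mathbf{w})\rangle=0,\qquad \langle\mu,B(\hat{\mathbf{u}}^n,\dot{\mathbf{u}}^n)\rangle=0;$$ set $\mathbf{u}^n=(4\mathbf{u}^{n-1}-\mathbf{u}^{n-2}+2s\dot{\mathbf{u}}^n)/3$. Stopping rule (checked at each step $n\ge3$): stop when $\big|\tfrac12 d_t\big(\mathcal{G}_{\mathcal{M}}(\mathbf{u}^n,\mathbf{u}^{n-1})+\|\dot{\mathbf{u}}^n\|_U^2\big)\big|\le\varepsilon$ or $n>[T_{max}/s]$; otherwise increase $n$ by one and continue.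
   Formalization: In (i) the inf-sup constant c>0 is required to be the same for all n (for n≥2, where the extrapolated iterates are defined); with c depending on n the minimality claim is false. *)

theory Defs
  imports "HOL-Analysis.Analysis"
begin

section \<open>Lipschitz domains and Sobolev functions\<close>

text \<open>Near every boundary point, and after a rotation that makes the unit vector \<open>e\<close> vertical,
  the domain is the part above the graph of a Lipschitz function \<open>h\<close> of the horizontal variables
  \<open>x - (x \<bullet> e) e\<close>.\<close>

definition bounded_lipschitz_domain :: "(real^'d) set \<Rightarrow> bool" where
  "bounded_lipschitz_domain \<Omega> \<longleftrightarrow>
     open \<Omega> \<and> connected \<Omega> \<and> \<Omega> \<noteq> {} \<and> bounded \<Omega> \<and>
     (\<forall>p\<in>frontier \<Omega>. \<exists>V e (h :: real^'d \<Rightarrow> real) L.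
        open V \<and> p \<in> V \<and> norm e = 1 \<and> L-lipschitz_on {y. y \<bullet> e = 0} h \<and>
        \<Omega> \<inter> V = {x\<in>V. x \<bullet> e > h (x - (x \<bullet> e) *\<^sub>R e)})"

text \<open>A family \<open>D\<close> indexed by lists of coordinate directions collects all iterated partial
  derivatives of the smooth function \<open>D []\<close>.\<close>

definition smooth_jet :: "('d list \<Rightarrow> real^'d \<Rightarrow> real) \<Rightarrow> bool" where
  "smooth_jet D \<longleftrightarrow>
     (\<forall>\<beta> x. (D \<beta> has_derivative (\<lambda>h. \<Sum>j\<in>UNIV. h $ j * D (j # \<beta>) x)) (at x))"

definition test_jet :: "(real^'d) set \<Rightarrow> ('d list \<Rightarrow> real^'d \<Rightarrow> real) \<Rightarrow> bool" where
  "test_jet \<Omega> D \<longleftrightarrow> smooth_jet D \<and> (\<exists>S. compact S \<and> S \<subseteq> \<Omega> \<and> (\<forall>x. x \<notin> S \<longrightarrow> D [] x = 0))"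

definition locally_integrable :: "(real^'d) set \<Rightarrow> (real^'d \<Rightarrow> real) \<Rightarrow> bool" where
  "locally_integrable \<Omega> f \<longleftrightarrow> (\<forall>S. compact S \<and> S \<subseteq> \<Omega> \<longrightarrow> set_integrable lebesgue S f)"

definition weak_partial ::
  "(real^'d) set \<Rightarrow> 'd list \<Rightarrow> (real^'d \<Rightarrow> real) \<Rightarrow> (real^'d \<Rightarrow> real) \<Rightarrow> bool" where
  "weak_partial \<Omega> \<beta> f f' \<longleftrightarrow>
     locally_integrable \<Omega> f \<and> locally_integrable \<Omega> f' \<and>
     (\<forall>D. test_jet \<Omega> D \<longrightarrow>
        (LINT x:\<Omega>|lebesgue. f x * D \<beta> x) =
        (-1) ^ length \<beta> * (LINT x:\<Omega>|lebesgue. f' x * D [] x))"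

definition weak_gradient ::
  "(real^'d) set \<Rightarrow> (real^'d \<Rightarrow> real^'m) \<Rightarrow> (real^'d \<Rightarrow> real^'d^'m) \<Rightarrow> bool" where
  "weak_gradient \<Omega> f G \<longleftrightarrow> (\<forall>i j. weak_partial \<Omega> [j] (\<lambda>x. f x $ i) (\<lambda>x. G x $ i $ j))"

definition square_integrable ::
  "(real^'d) set \<Rightarrow> (real^'d \<Rightarrow> 'b::euclidean_space) \<Rightarrow> bool" where
  "square_integrable \<Omega> f \<longleftrightarrow>
     f \<in> borel_measurable (lebesgue_on \<Omega>) \<and> integrable (lebesgue_on \<Omega>) (\<lambda>x. (norm (f x))\<^sup>2)"

definition h1_space :: "(real^'d) set \<Rightarrow> (real^'d \<Rightarrow> real^'m) set" where
  "h1_space \<Omega> =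
     {f. square_integrable \<Omega> f \<and> (\<exists>G. weak_gradient \<Omega> f G \<and> square_integrable \<Omega> G)}"

text \<open>The choice of the gradient does not matter, since weak gradients are unique up to null sets.
  The norm on \<open>real^'d^'m\<close> is the Frobenius norm.\<close>

definition h1_norm :: "(real^'d) set \<Rightarrow> (real^'d \<Rightarrow> real^'m) \<Rightarrow> real" where
  "h1_norm \<Omega> f =
     (let G = SOME G. weak_gradient \<Omega> f G
      in sqrt ((LINT x|lebesgue_on \<Omega>. (norm (f x))\<^sup>2) + (LINT x|lebesgue_on \<Omega>. (norm (G x))\<^sup>2)))"


section \<open>Function spaces on the domain\<close>

text \<open>A space of (classes of) functions on \<open>\<Omega>\<close> is a type together with a map \<open>\<rho>\<close> that chooses a
  representative of each element. As elements are identified when they agree almost everywhere,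
  \<open>\<rho>\<close> is linear and injective only up to null sets; values outside \<open>\<Omega>\<close> are irrelevant.\<close>

definition function_space ::
  "(real^'d) set \<Rightarrow> ('v::real_vector \<Rightarrow> real^'d \<Rightarrow> 'b::euclidean_space) \<Rightarrow> bool" where
  "function_space \<Omega> \<rho> \<longleftrightarrow>
     (\<forall>v. \<rho> v \<in> borel_measurable (lebesgue_on \<Omega>)) \<and>
     (\<forall>v w. AE x in lebesgue_on \<Omega>. \<rho> (v + w) x = \<rho> v x + \<rho> w x) \<and>
     (\<forall>a v. AE x in lebesgue_on \<Omega>. \<rho> (a *\<^sub>R v) x = a *\<^sub>R \<rho> v x) \<and>
     (\<forall>v. (AE x in lebesgue_on \<Omega>. \<rho> v x = 0) \<longrightarrow> v = 0)"

definition continuously_embedded_in_h1 ::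
  "(real^'d) set \<Rightarrow> ('u::real_normed_vector \<Rightarrow> real^'d \<Rightarrow> real^'m) \<Rightarrow> bool" where
  "continuously_embedded_in_h1 \<Omega> \<rho> \<longleftrightarrow>
     function_space \<Omega> \<rho> \<and> (\<forall>v. \<rho> v \<in> h1_space \<Omega>) \<and>
     (\<exists>C>0. \<forall>v. h1_norm \<Omega> (\<rho> v) \<le> C * norm v)"

text \<open>\<open>S\<close> has \<open>k\<close>-dimensional Hausdorff measure zero. (Radii are positive, so for \<open>k = 0\<close> this means
  that \<open>S\<close> is empty.)\<close>

definition hausdorff_null :: "nat \<Rightarrow> (real^'d) set \<Rightarrow> bool" where
  "hausdorff_null k S \<longleftrightarrow>
     (\<forall>e>0. \<exists>(I :: nat set) c r. (\<forall>i\<in>I. r i > 0) \<and> S \<subseteq> (\<Union>i\<in>I. cball (c i) (r i)) \<and>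
        (\<lambda>i. r i ^ k) summable_on I \<and> infsum (\<lambda>i. r i ^ k) I < (e :: real))"

text \<open>The trace of a Sobolev function on the boundary of a Lipschitz domain is determined, up to
  sets of surface measure zero, by the following averages over small balls.\<close>

definition boundary_value :: "(real^'d) set \<Rightarrow> (real^'d \<Rightarrow> real) \<Rightarrow> real^'d \<Rightarrow> real \<Rightarrow> bool" where
  "boundary_value \<Omega> f p c \<longleftrightarrow>
     (\<forall>\<^sub>F r in at_right 0. set_integrable lebesgue (\<Omega> \<inter> ball p r) f) \<and>
     ((\<lambda>r. (LINT x:\<Omega> \<inter> ball p r|lebesgue. \<bar>f x - c\<bar>) / measure lebesgue (\<Omega> \<inter> ball p r))
        \<longlongrightarrow> 0) (at_right 0)"

text \<open>The set \<open>K\<close> lists the components \<open>i\<close> and partial derivatives \<open>\<beta>\<close> that are prescribed on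
  \<open>\<Gamma>\<close>, and \<open>g i \<beta>\<close> are the prescribed values. For instance \<open>K = UNIV \<times> {[]}\<close> prescribes
  the function itself, and \<open>K = UNIV \<times> {\<beta>. length \<beta> \<le> 1}\<close> is a clamped condition.\<close>

definition dirichlet_set ::
  "(real^'d) set \<Rightarrow> ('u \<Rightarrow> real^'d \<Rightarrow> real^'m) \<Rightarrow> (real^'d) set \<Rightarrow> ('m \<times> 'd list) set \<Rightarrow>
   ('m \<Rightarrow> 'd list \<Rightarrow> real^'d \<Rightarrow> real) \<Rightarrow> 'u set" where
  "dirichlet_set \<Omega> \<rho> \<Gamma> K g =
     {v. \<forall>(i, \<beta>)\<in>K. \<exists>f. weak_partial \<Omega> \<beta> (\<lambda>x. \<rho> v x $ i) f \<and>
          hausdorff_null (CARD('d) - 1) {p\<in>\<Gamma>. \<not> boundary_value \<Omega> f p (g i \<beta> p)}}"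


section \<open>Weak topology and bidual\<close>

definition weak_topology :: "'a::real_normed_vector topology" where
  "weak_topology = topology_generated_by
     {f -` S | f S. bounded_linear (f :: 'a \<Rightarrow> real) \<and> open S}"

text \<open>Continuity from the weak topology to the norm topology is meant along sequences. Every map
  continuous between these topologies has this property (see below), but the converse
  fails already for compact linear operators, since a linear map that is continuous from the weak
  to the norm topology has finite rank.\<close>

definition weakly_continuous :: "('a::real_normed_vector \<Rightarrow> 'b::real_normed_vector) \<Rightarrow> bool" where
  "weakly_continuous F \<longleftrightarrow>
     (\<forall>x l. limitin weak_topology x l sequentially \<longrightarrow> (\<lambda>n. F (x n)) \<longlonglongrightarrow> F l)"

lemma weakly_continuousI_continuous_map:
  fixes F :: "'a::real_normed_vector \<Rightarrow> 'b::real_normed_vector"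
  assumes "continuous_map weak_topology euclidean F"
  shows "weakly_continuous F"
  unfolding weakly_continuous_def
proof (intro allI impI)
  fix x :: "nat \<Rightarrow> 'a" and l
  assume "limitin weak_topology x l sequentially"
  from continuous_map_limit[OF assms this] show "(\<lambda>n. F (x n)) \<longlonglongrightarrow> F l"
    by (simp add: comp_def)
qed

lemma limitin_weak_topology_iff:
  "limitin weak_topology x (l :: 'a::real_normed_vector) F \<longleftrightarrow>
     (\<forall>f. bounded_linear (f :: 'a \<Rightarrow> real) \<longrightarrow> ((\<lambda>n. f (x n)) \<longlongrightarrow> f l) F)"
proof -
  let ?G = "{f -` S | f S. bounded_linear (f :: 'a \<Rightarrow> real) \<and> open S}"
  have univ: "\<Union>?G = UNIV"
  proof -
    have "UNIV \<in> ?G"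
      using bounded_linear_zero open_UNIV vimage_UNIV by (metis (mono_tags, lifting) mem_Collect_eq)
    then show ?thesis by blast
  qed
  show ?thesis
  proof (intro iffI allI impI)
    fix f :: "'a \<Rightarrow> real"
    assume l: "limitin weak_topology x l F" and f: "bounded_linear f"
    show "((\<lambda>n. f (x n)) \<longlongrightarrow> f l) F"
    proof (rule topological_tendstoI)
      fix S assume S: "open S" "f l \<in> S"
      have "openin weak_topology (f -` S)"
        unfolding weak_topology_def using S f by (intro topology_generated_by_Basis) blast
      then show "\<forall>\<^sub>F n in F. f (x n) \<in> S"
        using l S unfolding limitin_def by auto
    qed
  next
    assume r: "\<forall>f. bounded_linear (f :: 'a \<Rightarrow> real) \<longrightarrow> ((\<lambda>n. f (x n)) \<longlongrightarrow> f l) F"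
    have "\<forall>\<^sub>F n in F. x n \<in> W" if "generate_topology_on ?G W" "l \<in> W" for W
      using that
    proof (induction rule: generate_topology_on.induct)
      case Empty
      then show ?case by simp
    next
      case (Int a b)
      then show ?case by (auto intro: eventually_elim2)
    next
      case (UN k)
      then obtain a where a: "a \<in> k" "l \<in> a" by blast
      then have "\<forall>\<^sub>F n in F. x n \<in> a" using UN by blast
      then show ?case by (rule eventually_mono) (use a in blast)
    next
      case (Basis s)
      then obtain f S where "s = f -` S" "bounded_linear (f :: 'a \<Rightarrow> real)" "open S" by blast
      then show ?case using r Basis topological_tendstoD[of "\<lambda>n. f (x n)" "f l" F S] by auto
    qed
    then show "limitin weak_topology x l F"
      unfolding limitin_def weak_topology_def
      using univ by (auto dest: openin_topology_generated_by)
  qed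
qed

text \<open>The canonical evaluation map into the bidual.\<close>

definition bidual_map ::
  "'z::real_normed_vector \<Rightarrow> ('z \<Rightarrow>\<^sub>L real) \<Rightarrow>\<^sub>L real" where
  "bidual_map z = Blinfun (\<lambda>\<mu>. blinfun_apply \<mu> z)"


section \<open>The constrained quadratic problem\<close>

definition quadratic_energy :: "('u \<Rightarrow> 'u \<Rightarrow> real) \<Rightarrow> 'u \<Rightarrow> real" where
  "quadratic_energy M u = M u u / 2"

definition admissible_set ::
  "(real^'d) set \<Rightarrow> ('z \<Rightarrow> real^'d \<Rightarrow> 'b::euclidean_space) \<Rightarrow> ('u \<Rightarrow> 'u \<Rightarrow> 'z) \<Rightarrow> 'z \<Rightarrow>
   'u set \<Rightarrow> 'u set" where
  "admissible_set \<Omega> \<zeta> B uc UD = {u\<in>UD. AE x in lebesgue_on \<Omega>. \<zeta> (B u u) x = \<zeta> uc x}"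

definition tangent_space ::
  "(real^'d) set \<Rightarrow> ('z \<Rightarrow> real^'d \<Rightarrow> 'b::euclidean_space) \<Rightarrow> ('u \<Rightarrow> 'u \<Rightarrow> 'z) \<Rightarrow>
   'u set \<Rightarrow> 'u \<Rightarrow> 'u set" where
  "tangent_space \<Omega> \<zeta> B U0 u = {v\<in>U0. AE x in lebesgue_on \<Omega>. \<zeta> (B u v) x = 0}"

definition G_form :: "('u \<Rightarrow> 'u \<Rightarrow> real) \<Rightarrow> 'u \<Rightarrow> 'u \<Rightarrow> real" where
  "G_form M u v = 5/2 * M u u - 2 * M u v + 1/2 * M v v"


section \<open>The BDF-2 accelerated flow\<close>

definition dt :: "real \<Rightarrow> (nat \<Rightarrow> 'a::real_vector) \<Rightarrow> nat \<Rightarrow> 'a" where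
  "dt s a n = (a n - a (n - 1)) /\<^sub>R s"

definition extrapolation :: "(nat \<Rightarrow> 'a::real_vector) \<Rightarrow> nat \<Rightarrow> 'a" where
  "extrapolation u n = 2 *\<^sub>R u (n - 1) - u (n - 2)"

text \<open>The velocities are collected in one sequence \<open>v\<close>: \<open>v 0\<close> and \<open>v 1\<close> are the backward
  differences of the iterates at times \<open>0\<close> and \<open>1\<close>, and \<open>v n\<close> for \<open>n \<ge> 2\<close> is the BDF-2 velocity.
  Hence the increments of the velocity in all steps are \<open>dt s v n\<close>. The relation between iterates
  and velocities is fixed by the last equation of each step.\<close>

definition bdf2_init :: "'u set \<Rightarrow> (nat \<Rightarrow> 'u::real_vector) \<Rightarrow> (nat \<Rightarrow> 'u) \<Rightarrow> bool" where
  "bdf2_init Adm u v \<longleftrightarrow> u 0 \<in> Adm \<and> v 0 = 0"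

definition bdf2_step1 ::
  "real \<Rightarrow> real \<Rightarrow> ('u::real_inner \<Rightarrow> 'u \<Rightarrow> real) \<Rightarrow> ('u \<Rightarrow> 'u set) \<Rightarrow>
   (nat \<Rightarrow> 'u) \<Rightarrow> (nat \<Rightarrow> 'u) \<Rightarrow> bool" where
  "bdf2_step1 s \<alpha> M F u v \<longleftrightarrow>
     v 1 \<in> F (u 0) \<and>
     (\<forall>w\<in>F (u 0). inner (dt s v 1) w + \<alpha> / s * inner (v 1) w + M (u 0 + s *\<^sub>R v 1) w = 0) \<and>
     u 1 = u 0 + s *\<^sub>R v 1"

definition bdf2_step2 ::
  "real \<Rightarrow> real \<Rightarrow> ('u::real_inner \<Rightarrow> 'u \<Rightarrow> real) \<Rightarrow> ('u \<Rightarrow> 'u set) \<Rightarrow>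
   (nat \<Rightarrow> 'u) \<Rightarrow> (nat \<Rightarrow> 'u) \<Rightarrow> bool" where
  "bdf2_step2 s \<alpha> M F u v \<longleftrightarrow>
     v 2 \<in> F (extrapolation u 2) \<and>
     (\<forall>w\<in>F (extrapolation u 2).
        inner (dt s v 2) w + \<alpha> / (2 * s) * inner (v 2) w
          + 1/3 * M (4 *\<^sub>R u 1 - u 0 + (2 * s) *\<^sub>R v 2) w = 0) \<and>
     u 2 = (1/3) *\<^sub>R (4 *\<^sub>R u 1 - u 0 + (2 * s) *\<^sub>R v 2)"

definition bdf2_saddle_step ::
  "real \<Rightarrow> real \<Rightarrow> ('u::real_inner \<Rightarrow> 'u \<Rightarrow> real) \<Rightarrow> ('u \<Rightarrow> 'u \<Rightarrow> 'z::real_normed_vector) \<Rightarrow>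
   'u set \<Rightarrow> (nat \<Rightarrow> 'u) \<Rightarrow> (nat \<Rightarrow> 'u) \<Rightarrow> (nat \<Rightarrow> 'z \<Rightarrow>\<^sub>L real) \<Rightarrow> nat \<Rightarrow> bool" where
  "bdf2_saddle_step s \<alpha> M B U0 u v lam n \<longleftrightarrow>
     v n \<in> U0 \<and>
     (\<forall>w\<in>U0. inner (dt s v n) w + \<alpha> / (real n * s) * inner (v n) w
        + 1/3 * M (4 *\<^sub>R u (n - 1) - u (n - 2) + (2 * s) *\<^sub>R v n) w
        + blinfun_apply (lam n) (B (extrapolation u n) w) = 0) \<and>
     (\<forall>\<mu> :: 'z \<Rightarrow>\<^sub>L real. blinfun_apply \<mu> (B (extrapolation u n) (v n)) = 0) \<and>
     u n = (1/3) *\<^sub>R (4 *\<^sub>R u (n - 1) - u (n - 2) + (2 * s) *\<^sub>R v n)"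

definition bdf2_stop ::
  "real \<Rightarrow> real \<Rightarrow> real \<Rightarrow> ('u::real_inner \<Rightarrow> 'u \<Rightarrow> real) \<Rightarrow>
   (nat \<Rightarrow> 'u) \<Rightarrow> (nat \<Rightarrow> 'u) \<Rightarrow> nat \<Rightarrow> bool" where
  "bdf2_stop s \<epsilon> Tmax M u v n \<longleftrightarrow>
     \<bar>1/2 * dt s (\<lambda>k. G_form M (u k) (u (k - 1)) + (norm (v k))\<^sup>2) n\<bar> \<le> \<epsilon> \<or>
     int n > \<lfloor>Tmax / s\<rfloor>"

text \<open>The algorithm, run with tolerance \<open>\<epsilon>\<close> and maximal time \<open>Tmax\<close>, performs the steps
  \<open>1, \<dots>, N\<close> with outputs \<open>u\<close>, \<open>v\<close>, \<open>lam\<close> (later entries of the sequences are not constrained), and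
  \<open>N\<close> is the first step \<open>\<ge> 3\<close> at which the stopping rule applies.\<close>

definition bdf2_run ::
  "real \<Rightarrow> real \<Rightarrow> ('u::real_inner \<Rightarrow> 'u \<Rightarrow> real) \<Rightarrow> ('u \<Rightarrow> 'u \<Rightarrow> 'z::real_normed_vector) \<Rightarrow>
   'u set \<Rightarrow> 'u set \<Rightarrow> ('u \<Rightarrow> 'u set) \<Rightarrow> (nat \<Rightarrow> 'u) \<Rightarrow> (nat \<Rightarrow> 'u) \<Rightarrow> (nat \<Rightarrow> 'z \<Rightarrow>\<^sub>L real) \<Rightarrow>
   real \<Rightarrow> real \<Rightarrow> nat \<Rightarrow> bool" where
  "bdf2_run s \<alpha> M B U0 Adm F u v lam \<epsilon> Tmax N \<longleftrightarrow>
     bdf2_init Adm u v \<and> bdf2_step1 s \<alpha> M F u v \<and> bdf2_step2 s \<alpha> M F u v \<and>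
     3 \<le> N \<and>
     (\<forall>n\<in>{3..N}. bdf2_saddle_step s \<alpha> M B U0 u v lam n) \<and>
     (\<forall>n\<in>{3..<N}. \<not> bdf2_stop s \<epsilon> Tmax M u v n) \<and>
     bdf2_stop s \<epsilon> Tmax M u v N"

text \<open>The constant does not depend on the step; otherwise the multipliers need not stay bounded and
  the limit of the iterates need not be a minimizer. The extrapolated iterates exist for \<open>n \<ge> 2\<close>.\<close>

definition inf_sup_stable ::
  "('u::real_normed_vector \<Rightarrow> 'u \<Rightarrow> 'z::real_normed_vector) \<Rightarrow> 'u set \<Rightarrow> (nat \<Rightarrow> 'u) \<Rightarrow> bool" where
  "inf_sup_stable B U0 u \<longleftrightarrow>
     (\<exists>c>0. \<forall>n\<ge>2.
        (INF \<mu>\<in>{\<mu> :: 'z \<Rightarrow>\<^sub>L real. \<mu> \<noteq> 0}. SUP w\<in>{w\<in>U0. w \<noteq> 0}.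
           ereal (blinfun_apply \<mu> (B (extrapolation u n) w) / (norm w * norm \<mu>))) \<ge> ereal c)"

end

(*
Testing the saddle-point step with the new velocity removes the multiplier, and the BDF-2 identity
turns the step into an energy balance. The dissipated terms are therefore summable: velocity
increments and second differences of the iterates tend to zero, and the sum of |v n|^2 / n is finite.
As the harmonic series diverges, v tends to zero along a subsequence, and a further subsequence of
the bounded iterates converges weakly to some u'. The inf-sup condition bounds the multipliers, so
for a direction w tangent at u' the multiplier term vanishes in the limit of the step equation,
leaving M u' w = 0. Since the energy is a nonnegative quadratic form, stationarity is minimality.
*)

theory Submission
  imports Defs "HOL-Complex_Analysis.Great_Picard"
begin

section \<open>Weak sequential compactness of bounded sequences in a Hilbert space\<close>

text \<open>Linearity and the bound are asked for on \<open>S\<close> alone because the functional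
  it will represent is a limit of inner products that exists only on a subspace.\<close>

lemma riesz_on_closed_subspace:
  fixes f :: "'a::{real_inner, complete_space} \<Rightarrow> real"
  assumes S: "subspace S" "closed S"
    and add: "\<And>x y. x \<in> S \<Longrightarrow> y \<in> S \<Longrightarrow> f (x + y) = f x + f y"
    and scale: "\<And>c x. x \<in> S \<Longrightarrow> f (c *\<^sub>R x) = c * f x"
    and bound: "\<And>x. x \<in> S \<Longrightarrow> \<bar>f x\<bar> \<le> K * norm x"
  obtains p where "p \<in> S" "\<And>x. x \<in> S \<Longrightarrow> f x = inner p x"
proof -
  \<comment> \<open>The representer minimizes \<open>J\<close> on \<open>S\<close>; minimizing sequences are Cauchy by the parallelogram law.\<close>
  define J where "J x = (norm x)\<^sup>2 - 2 * f x" for x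
  have diff: "f (x - y) = f x - f y" if "x \<in> S" "y \<in> S" for x y
    using add[of x "-1 *\<^sub>R y"] scale[of y "-1"] that S(1) by (simp add: subspace_neg)
  have J_ge: "J x \<ge> - K\<^sup>2" if "x \<in> S" for x
  \<comment> \<open>Completing the square: \<open>J x\<close> is at least
    \<open>(norm x - K)^2 - K^2\<close> by the bound on \<open>f\<close>.\<close>
  proof -
    have "0 \<le> (norm x - K)\<^sup>2" by simp
    then show ?thesis using bound[OF that] unfolding J_def by (simp add: power2_diff algebra_simps)
  qed
  have bdd: "bdd_below (J ` S)" using J_ge by (auto intro!: bdd_belowI)
  define m where "m = (INF x\<in>S. J x)"
  have m_le: "m \<le> J x" if "x \<in> S" for x
    unfolding m_def by (rule cINF_lower[OF bdd that])
  have "S \<noteq> {}" using S(1) subspace_0 by blast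
  then have "\<exists>x\<in>S. J x < m + 1 / real (Suc n)" for n
    using cINF_less_iff[OF _ bdd, of "m + 1 / real (Suc n)"] unfolding m_def by simp
  then obtain x where x: "\<And>n. x n \<in> S" "\<And>n. J (x n) < m + 1 / real (Suc n)" by metis
  have para: "(norm (y - z))\<^sup>2 = 2 * J y + 2 * J z - 4 * J ((1/2) *\<^sub>R (y + z))"
    if "y \<in> S" "z \<in> S" for y z
  proof -
    have "f ((1/2) *\<^sub>R (y + z)) = (f y + f z) / 2"
      using scale[of "y + z" "1/2"] add[OF that] that S(1) by (simp add: subspace_add)
    then show ?thesis unfolding J_def
      by (simp add: power2_norm_eq_inner inner_simps inner_commute field_simps)
  qed
  have near: "(norm (x i - x j))\<^sup>2 \<le> 2 / real (Suc i) + 2 / real (Suc j)" for i j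
  proof -
    have "(1/2) *\<^sub>R (x i + x j) \<in> S" using x(1) S(1) by (simp add: subspace_add subspace_scale)
    from m_le[OF this] show ?thesis
      using para[OF x(1) x(1), of i j] x(2)[of i] x(2)[of j] by linarith
  qed
  have "Cauchy x"
  proof (rule metric_CauchyI)
    fix e :: real assume "e > 0"
    then obtain n0 where n0: "inverse (real (Suc n0)) < e\<^sup>2 / 4"
      using reals_Archimedean[of "e\<^sup>2 / 4"] by auto
    show "\<exists>M. \<forall>i\<ge>M. \<forall>j\<ge>M. dist (x i) (x j) < e"
    proof (intro exI allI impI)
      fix i j assume "n0 \<le> i" "n0 \<le> j"
      then have "2 / real (Suc i) \<le> 2 / real (Suc n0)" "2 / real (Suc j) \<le> 2 / real (Suc n0)"
        by (auto intro!: divide_left_mono)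
      moreover have "2 / real (Suc n0) < e\<^sup>2 / 2" using n0 by (simp add: inverse_eq_divide)
      ultimately have "(norm (x i - x j))\<^sup>2 < e\<^sup>2" using near[of i j] by linarith
      then show "dist (x i) (x j) < e"
        using \<open>e > 0\<close> by (simp add: dist_norm power2_less_imp_less)
    qed
  qed
  then obtain p where p: "x \<longlonglongrightarrow> p" using Cauchy_convergent convergent_def by blast
  have pS: "p \<in> S" using closed_sequentially[OF S(2)] x(1) p by blast
  have "(\<lambda>n. f (x n) - f p) \<longlonglongrightarrow> 0"
  proof (rule Lim_null_comparison)
    show "(\<lambda>n. K * norm (x n - p)) \<longlonglongrightarrow> 0"
      using tendsto_mult_right_zero[OF tendsto_norm_zero[OF LIM_zero[OF p]]] by simp
    show "\<forall>\<^sub>F n in sequentially. norm (f (x n) - f p) \<le> K * norm (x n - p)"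
      using bound[of "x _ - p"] diff[OF x(1) pS] x(1) pS S(1)
      by (intro always_eventually allI) (metis real_norm_def subspace_diff)
  qed
  then have "(\<lambda>n. f (x n)) \<longlonglongrightarrow> f p" by (rule LIM_zero_cancel)
  then have "(\<lambda>n. J (x n)) \<longlonglongrightarrow> J p" unfolding J_def by (intro tendsto_intros p)
  moreover have "(\<lambda>n. m + 1 / real (Suc n)) \<longlonglongrightarrow> m + 0"
    using LIMSEQ_inverse_real_of_nat by (intro tendsto_intros) (simp add: inverse_eq_divide)
  ultimately have "J p \<le> m + 0"
    by (rule LIMSEQ_le) (use x(2) less_imp_le in blast)
  then have Jp: "J p \<le> J z" if "z \<in> S" for z using m_le[OF that] by simp
  have "f w = inner p w" if w: "w \<in> S" for w
  proof (rule ccontr)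
    assume "f w \<noteq> inner p w"
    define d where "d = f w - inner p w"
    have "d \<noteq> 0" using \<open>f w \<noteq> inner p w\<close> unfolding d_def by simp
    \<comment> \<open>Moving from the minimizer \<open>p\<close> by \<open>t\<close> times
      \<open>w\<close> changes \<open>J\<close> by \<open>t^2 (norm w)^2 - 2 t d\<close>, which
      cannot be negative.\<close>
    have ineq: "2 * t * d \<le> t\<^sup>2 * (norm w)\<^sup>2" for t
    proof -
      have "t *\<^sub>R w \<in> S" using w S(1) by (simp add: subspace_scale)
      then have "J p \<le> J (p + t *\<^sub>R w)" "f (p + t *\<^sub>R w) = f p + t * f w"
        using Jp pS S(1) add scale w by (simp_all add: subspace_add)
      then show ?thesis unfolding J_def d_def power2_norm_eq_inner
        by (simp add: inner_simps inner_commute algebra_simps power2_eq_square)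
    qed
    \<comment> \<open>The added \<open>1\<close> keeps \<open>a\<close> positive even for
      \<open>w = 0\<close>. With \<open>t = d / a\<close> the inequality becomes
      \<open>2 d^2 / a \<le> d^2 / a\<close>, which forces \<open>d = 0\<close>.\<close>
    define a where "a = (norm w)\<^sup>2 + 1"
    have a: "a > 0" "(norm w)\<^sup>2 \<le> a" unfolding a_def by (auto intro: add_nonneg_pos)
    have "2 * (d / a) * d \<le> (d / a)\<^sup>2 * a"
      using ineq[of "d / a"] mult_left_mono[OF a(2), of "(d / a)\<^sup>2"] by simp
    then have "d\<^sup>2 \<le> 0" using a(1) by (simp add: field_simps power2_eq_square)
    then show False using \<open>d \<noteq> 0\<close> by simp
  qed
  with pS show thesis using that by blast
qed

text \<open>The diagonal extraction tests against the terms of the sequence itself, a countable set,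
  instead of a dense subset of the space. Convergence then spreads to a closed subspace containing
  the sequence, where Riesz represents the limit functional by the weak limit.\<close>

lemma bounded_imp_weakly_convergent_subsequence:
  fixes x :: "nat \<Rightarrow> 'a::{real_inner, complete_space}"
  assumes C: "\<And>n. norm (x n) \<le> C"
  obtains r l where "strict_mono r" "limitin weak_topology (x \<circ> r) l sequentially"
proof -
  have C0: "C \<ge> 0" using C[of 0] norm_ge_zero order_trans by blast
  have "norm (inner (x n) y) \<le> C * C" if "y \<in> range x" for n y
    using that C C0 Cauchy_Schwarz_ineq2[of "x n" y] mult_mono[of "norm (x n)" C "norm y" C]
    by force
  then obtain r where r: "strict_mono r"
    "\<And>y. y \<in> range x \<Longrightarrow> \<exists>l. (\<lambda>n. inner (x (r n)) y) \<longlonglongrightarrow> l"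
    using function_convergent_subsequence[OF countable_image[OF countableI_type, of x UNIV], of "\<lambda>n y. inner (x n) y" "C * C"]
    by metis
  define S where "S = {y. convergent (\<lambda>n. inner (x (r n)) y)}"
  have xS: "x n \<in> S" for n using r(2) unfolding S_def convergent_def by blast
  have sub: "subspace S"
    unfolding subspace_def S_def
    by (auto simp: inner_simps intro: convergent_add convergent_mult convergent_const)
  have clos: "closed S"
    unfolding closure_subset_eq[symmetric]
  proof
    fix y assume y: "y \<in> closure S"
    have "Cauchy (\<lambda>n. inner (x (r n)) y)"
    proof (rule metric_CauchyI)
      fix e :: real assume e: "e > 0"
      \<comment> \<open>An \<open>e / 3\<close> argument; \<open>C + 1\<close> avoids division by
        zero when \<open>C = 0\<close>.\<close>
      define d where "d = e / (3 * (C + 1))"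
      have d: "d > 0" "C * d \<le> e / 3" using e C0 unfolding d_def by (auto simp: field_simps)
      obtain z where z: "z \<in> S" "norm (z - y) < d"
        using y d(1) unfolding closure_approachable dist_norm by blast
      have close: "\<bar>inner (x (r n)) z - inner (x (r n)) y\<bar> \<le> e / 3" for n
      proof -
        have "\<bar>inner (x (r n)) (z - y)\<bar> \<le> C * d"
          using Cauchy_Schwarz_ineq2[of "x (r n)" "z - y"] mult_mono[OF C[of "r n"] less_imp_le[OF z(2)]]
            C0 by simp
        then show ?thesis using d(2) by (simp add: inner_diff_right)
      qed
      have "Cauchy (\<lambda>n. inner (x (r n)) z)"
        using z(1) unfolding S_def by (simp add: Cauchy_convergent_iff)
      then obtain n0 where n0: "\<And>i j. i \<ge> n0 \<Longrightarrow> j \<ge> n0 \<Longrightarrow>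
          \<bar>inner (x (r i)) z - inner (x (r j)) z\<bar> < e / 3"
        using e unfolding Cauchy_def dist_real_def by (meson divide_pos_pos zero_less_numeral)
      show "\<exists>n0. \<forall>i\<ge>n0. \<forall>j\<ge>n0. dist (inner (x (r i)) y) (inner (x (r j)) y) < e"
      proof (intro exI allI impI)
        fix i j assume "n0 \<le> i" "n0 \<le> j"
        then show "dist (inner (x (r i)) y) (inner (x (r j)) y) < e"
          using n0[of i j] close[of i] close[of j] unfolding dist_real_def by linarith
      qed
    qed
    then show "y \<in> S" unfolding S_def by (simp add: Cauchy_convergent_iff)
  qed
  define f where "f y = lim (\<lambda>n. inner (x (r n)) y)" for y
  have f: "(\<lambda>n. inner (x (r n)) y) \<longlonglongrightarrow> f y" if "y \<in> S" for y
    using that unfolding S_def f_def by (simp add: convergent_LIMSEQ_iff)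
  obtain p where p: "p \<in> S" "\<And>y. y \<in> S \<Longrightarrow> f y = inner p y"
  proof (rule riesz_on_closed_subspace[OF sub clos])
    fix y z assume "y \<in> S" "z \<in> S"
    then show "f (y + z) = f y + f z"
      using tendsto_add[OF f f] f[of "y + z"] sub
      by (auto simp: inner_simps subspace_add intro: LIMSEQ_unique)
  next
    fix c y assume "y \<in> S"
    then show "f (c *\<^sub>R y) = c * f y"
      using tendsto_mult_left[OF f, of y c] f[of "c *\<^sub>R y"] sub
      by (auto simp: inner_simps subspace_scale intro: LIMSEQ_unique)
  next
    fix y assume y: "y \<in> S"
    have "\<bar>inner (x (r n)) y\<bar> \<le> C * norm y" for n
      using Cauchy_Schwarz_ineq2[of "x (r n)" y] mult_right_mono[OF C norm_ge_zero]
      by (rule order_trans)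
    then show "\<bar>f y\<bar> \<le> C * norm y"
      using tendsto_rabs[OF f[OF y]] by (intro LIMSEQ_le_const2) auto
  qed blast
  \<comment> \<open>On \<open>S\<close>, which contains the sequence, an arbitrary functional is represented by some \<open>q \<in> S\<close>.\<close>
  have "(\<lambda>n. g (x (r n))) \<longlonglongrightarrow> g p" if g: "bounded_linear g" for g :: "'a \<Rightarrow> real"
  proof -
    interpret g: bounded_linear g by (rule g)
    obtain K where "\<And>y. norm (g y) \<le> norm y * K" using g.bounded by blast
    then obtain q where q: "q \<in> S" "\<And>y. y \<in> S \<Longrightarrow> g y = inner q y"
      using riesz_on_closed_subspace[OF sub clos, of g K] g.add g.scale
      by (auto simp: mult.commute)
    show ?thesis
      using f[OF q(1)] p(2)[OF q(1)] q(2)[OF xS] q(2)[OF p(1)] by (simp add: inner_commute)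
  qed
  then have "limitin weak_topology (x \<circ> r) p sequentially"
    unfolding limitin_weak_topology_iff by simp
  with r(1) show thesis using that by blast
qed

section \<open>Discrete energy law of the BDF-2 step\<close>

text \<open>This is the G-stability of the BDF-2 difference: the update says
  \<open>2 s v = 3 a - 4 b + c\<close>, and pairing this with \<open>a\<close> splits into an
  increment of \<open>G_form\<close> plus the form of the second difference.\<close>

lemma bdf2_identity:
  assumes M: "bilinear M" "\<And>x y. M x y = M y x"
    and a: "a = (1/3) *\<^sub>R (4 *\<^sub>R b - c + (2 * s) *\<^sub>R v)"
  shows "4 * s * M a v =
    2 * (G_form M a b - G_form M b c) + M (a - 2 *\<^sub>R b + c) (a - 2 *\<^sub>R b + c)"
proof -
  note expand = bilinear_ladd[OF M(1)] bilinear_radd[OF M(1)] bilinear_lsub[OF M(1)]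
    bilinear_rsub[OF M(1)] bilinear_lmul[OF M(1)] bilinear_rmul[OF M(1)]
  have "(2 * s) *\<^sub>R v = 3 *\<^sub>R a - 4 *\<^sub>R b + c" unfolding a by simp
  then have "2 * s * M a v = M a (3 *\<^sub>R a - 4 *\<^sub>R b + c)"
    using bilinear_rmul[OF M(1), of a "2 * s" v] by simp
  then show ?thesis
    using M(2)[of a b] M(2)[of a c] M(2)[of b c] unfolding G_form_def
    by (simp add: expand algebra_simps)
qed

text \<open>The energy lost in one step consists of the squared velocity increment, the friction
  term and the form of the second difference of the iterates.\<close>

lemma bdf2_energy_dissipation:
  assumes M: "bilinear M" "\<And>x y. M x y = M y x" and s: "s > 0" and n: "n \<ge> 2"
    and step: "bdf2_saddle_step s \<alpha> M B U\<^sub>0 u v lam n"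
  shows "G_form M (u n) (u (n - 1)) + (norm (v n))\<^sup>2 + (norm (v n - v (n - 1)))\<^sup>2
      + 2 * \<alpha> / real n * (norm (v n))\<^sup>2
      + M (u n - 2 *\<^sub>R u (n - 1) + u (n - 2)) (u n - 2 *\<^sub>R u (n - 1) + u (n - 2)) / 2
    = G_form M (u (n - 1)) (u (n - 2)) + (norm (v (n - 1)))\<^sup>2"
proof -
  have un: "u n = (1/3) *\<^sub>R (4 *\<^sub>R u (n - 1) - u (n - 2) + (2 * s) *\<^sub>R v n)"
    using step unfolding bdf2_saddle_step_def by blast
  \<comment> \<open>The test vector is \<open>v n\<close>; the constraint equation with
    \<open>\<mu> = lam n\<close> removes the multiplier.\<close>
  have "inner (dt s v n) (v n) + \<alpha> / (real n * s) * inner (v n) (v n)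
      + 1/3 * M (4 *\<^sub>R u (n - 1) - u (n - 2) + (2 * s) *\<^sub>R v n) (v n) = 0"
    using step unfolding bdf2_saddle_step_def by force
  moreover have "1/3 * M (4 *\<^sub>R u (n - 1) - u (n - 2) + (2 * s) *\<^sub>R v n) (v n) = M (u n) (v n)"
    unfolding un by (simp add: bilinear_lmul[OF M(1)])
  moreover have "2 * s * inner (dt s v n) (v n)
      = (norm (v n))\<^sup>2 - (norm (v (n - 1)))\<^sup>2 + (norm (v n - v (n - 1)))\<^sup>2"
    using s by (simp add: dt_def power2_norm_eq_inner inner_simps inner_commute field_simps)
  moreover have "2 * s * (\<alpha> / (real n * s) * inner (v n) (v n)) = 2 * \<alpha> / real n * (norm (v n))\<^sup>2"
    using s by (simp add: power2_norm_eq_inner)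
  ultimately have "(norm (v n))\<^sup>2 - (norm (v (n - 1)))\<^sup>2 + (norm (v n - v (n - 1)))\<^sup>2
      + 2 * \<alpha> / real n * (norm (v n))\<^sup>2 + 2 * s * M (u n) (v n) = 2 * s * 0"
    by (metis distrib_left)
  then show ?thesis
    using bdf2_identity[OF M un] by simp
qed

text \<open>Completing the square with the extrapolated value \<open>2 a - b\<close>. This makes the
  discrete energy coercive in the newest iterate.\<close>

lemma G_form_ge:
  assumes M: "bilinear M" "\<And>x y. M x y = M y x" "\<And>x. M x x \<ge> 0"
  shows "G_form M a b \<ge> M a a / 2"
proof -
  have "G_form M a b = M a a / 2 + M (2 *\<^sub>R a - b) (2 *\<^sub>R a - b) / 2"
    unfolding G_form_def using M(2)[of a b]
    by (simp add: bilinear_lsub[OF M(1)] bilinear_rsub[OF M(1)] bilinear_lmul[OF M(1)]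
        bilinear_rmul[OF M(1)] field_simps)
  then show ?thesis using M(3)[of "2 *\<^sub>R a - b"] by linarith
qed

section \<open>Summable dissipation and asymptotics of the iteration\<close>

text \<open>Staying above some \<open>e > 0\<close> from an index on would let the series dominate a
  multiple of the harmonic series. Since the friction coefficient decays like \<open>1 / n\<close>,
  only this weighted sum of squared velocities is controlled.\<close>

lemma summable_harmonic_weight_imp_null_subsequence:
  fixes a :: "nat \<Rightarrow> real"
  assumes nonneg: "\<And>n. a n \<ge> 0" and sum: "summable (\<lambda>n. a n / real n)"
  obtains r where "strict_mono r" "(a \<circ> r) \<longlonglongrightarrow> 0"
proof -
  have ex: "\<exists>n>m. a n < e" if e: "e > 0" for e m
  proof (rule ccontr)
    assume "\<not> ?thesis"
    then have ge: "a n \<ge> e" if "n > m" for n using that not_less by blast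
    have "summable (\<lambda>n. inverse (real n))"
    proof (rule summable_comparison_test)
      show "summable (\<lambda>n. (1 / e) * (a n / real n))" by (rule summable_mult[OF sum])
      show "\<exists>n0. \<forall>n\<ge>n0. norm (inverse (real n)) \<le> (1 / e) * (a n / real n)"
      proof (intro exI allI impI)
        fix n assume "n \<ge> Suc m"
        then have "e \<le> a n" "real n > 0" using ge by auto
        then show "norm (inverse (real n)) \<le> (1 / e) * (a n / real n)"
          using e by (simp add: field_simps)
      qed
    qed
    then show False using not_summable_harmonic by blast
  qed
  have "\<exists>r. \<forall>n. a (r n) < 1 / real (Suc n) \<and> r n < r (Suc n)"
  proof (rule dependent_nat_choice)
    show "\<exists>x. a x < 1 / real (Suc 0)" using ex[of 1] by auto
    show "\<exists>y. a y < 1 / real (Suc (Suc n)) \<and> x < y" for x n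
      using ex[of "1 / real (Suc (Suc n))" x] by auto
  qed
  then obtain r where r: "\<And>n. a (r n) < 1 / real (Suc n)" "\<And>n. r n < r (Suc n)" by blast
  have "(a \<circ> r) \<longlonglongrightarrow> 0"
  proof (rule Lim_null_comparison[OF _ LIMSEQ_inverse_real_of_nat])
    show "\<forall>\<^sub>F n in sequentially. norm ((a \<circ> r) n) \<le> inverse (real (Suc n))"
      using r(1) nonneg by (intro always_eventually allI) (simp add: inverse_eq_divide less_imp_le)
  qed
  then show thesis using that r(2) unfolding strict_mono_Suc_iff by blast
qed

text \<open>The energy \<open>E\<close> is nonnegative and decreases from index \<open>2\<close> on,
  so its drops form a convergent telescoping series that dominates each dissipated term. Coercivity
  turns the energy bound into bounds on \<open>u\<close> and \<open>v\<close>.\<close>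

lemma bdf2_asymptotics:
  fixes u v :: "nat \<Rightarrow> 'u::real_inner"
  assumes M: "bilinear M" "\<And>x y. M x y = M y x" "C\<^sub>1 > 0" "\<And>x. M x x \<ge> C\<^sub>1 * (norm x)\<^sup>2"
    and s: "s > 0" "\<alpha> > 0"
    and step: "\<And>n. n \<ge> 3 \<Longrightarrow> bdf2_saddle_step s \<alpha> M B U\<^sub>0 u v lam n"
  shows "Bseq u" "Bseq v" "(\<lambda>n. v n - v (n - 1)) \<longlonglongrightarrow> 0"
    "(\<lambda>n. u n - 2 *\<^sub>R u (n - 1) + u (n - 2)) \<longlonglongrightarrow> 0"
    "summable (\<lambda>n. (norm (v n))\<^sup>2 / real n)"
proof -
  define E where "E n = G_form M (u n) (u (n - 1)) + (norm (v n))\<^sup>2" for n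
  define \<delta> where "\<delta> n = u n - 2 *\<^sub>R u (n - 1) + u (n - 2)" for n
  have pos: "M x x \<ge> 0" for x using M(3) M(4)[of x] by (smt (verit) mult_nonneg_nonneg zero_le_power2)
  have E_ge: "C\<^sub>1 / 2 * (norm (u n))\<^sup>2 + (norm (v n))\<^sup>2 \<le> E n" for n
    using G_form_ge[OF M(1,2) pos, of "u n" "u (n - 1)"] M(4)[of "u n"] unfolding E_def by simp
  have diss: "(norm (v n - v (n - 1)))\<^sup>2 + 2 * \<alpha> * ((norm (v n))\<^sup>2 / real n)
      + C\<^sub>1 / 2 * (norm (\<delta> n))\<^sup>2 \<le> E (n - 1) - E n" if "n \<ge> 3" for n
    using bdf2_energy_dissipation[OF M(1,2) s(1) _ step[OF that]] M(4)[of "\<delta> n"] that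
    unfolding E_def \<delta>_def by (simp add: numeral_2_eq_2)
  have mono: "E n \<le> E (n - 1)" if "n \<ge> 3" for n
    using diss[OF that] M(3) s(2)
    by (smt (verit) divide_nonneg_nonneg mult_nonneg_nonneg of_nat_0_le_iff zero_le_power2)
  have dec: "decseq (\<lambda>k. E (k + 2))"
    using mono[of "Suc _ + 2"] by (intro decseq_SucI) simp
  have E_nonneg: "0 \<le> E n" for n
    using E_ge[of n] M(3) by (smt (verit) divide_nonneg_pos mult_nonneg_nonneg zero_le_power2)
  obtain L where "(\<lambda>k. E (k + 2)) \<longlonglongrightarrow> L"
    using decseq_convergent[OF dec] E_nonneg by blast
  \<comment> \<open>The first controlled drop, at \<open>k = 0\<close>, is \<open>E 2 - E 3\<close>,
    the one of the first saddle-point step; finitely many earlier terms do not affect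
    summability.\<close>
  from telescope_summable'[OF this] have "summable (\<lambda>k. E ((k + 3) - 1) - E (k + 3))"
    by (simp add: numeral_eq_Suc)
  then have sum: "summable (\<lambda>n. E (n - 1) - E n)" by (rule summable_iff_shift[THEN iffD1])
  \<comment> \<open>Common pattern for the three dissipated quantities: each alone, up to a positive
    factor, lies below the energy drop.\<close>
  have part: "summable f" if "\<And>n. f n \<ge> 0" "\<And>n. n \<ge> 3 \<Longrightarrow> c * f n \<le> E (n - 1) - E n" "c > 0"
    for f :: "nat \<Rightarrow> real" and c
  proof -
    have "summable (\<lambda>n. c * f n)"
      by (rule summable_comparison_test[OF _ sum]) (use that in \<open>auto intro!: exI[of _ 3]\<close>)
    then show ?thesis using that(3) by (simp add: summable_cmult_iff)
  qed
  have nonneg: "0 \<le> (norm (v n - v (n - 1)))\<^sup>2" "0 \<le> 2 * \<alpha> * ((norm (v n))\<^sup>2 / real n)"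
    "0 \<le> C\<^sub>1 / 2 * (norm (\<delta> n))\<^sup>2" for n
    using M(3) s(2) by simp_all
  show "summable (\<lambda>n. (norm (v n))\<^sup>2 / real n)"
  proof (rule part)
    show "2 * \<alpha> * ((norm (v n))\<^sup>2 / real n) \<le> E (n - 1) - E n" if "n \<ge> 3" for n
      using diss[OF that] nonneg[of n] by linarith
  qed (use s in auto)
  have null: "f \<longlonglongrightarrow> 0" if "summable (\<lambda>n. (norm (f n))\<^sup>2)" for f :: "nat \<Rightarrow> 'u"
    using tendsto_real_sqrt[OF summable_LIMSEQ_zero[OF that]] by (simp add: tendsto_norm_zero_iff)
  show "(\<lambda>n. v n - v (n - 1)) \<longlonglongrightarrow> 0"
  proof (intro null part)
    show "1 * (norm (v n - v (n - 1)))\<^sup>2 \<le> E (n - 1) - E n" if "n \<ge> 3" for n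
      using diss[OF that] nonneg[of n] by linarith
  qed auto
  have "\<delta> \<longlonglongrightarrow> 0"
  proof (intro null part)
    show "C\<^sub>1 / 2 * (norm (\<delta> n))\<^sup>2 \<le> E (n - 1) - E n" if "n \<ge> 3" for n
      using diss[OF that] nonneg[of n] by linarith
  qed (use M(3) in auto)
  then show "(\<lambda>n. u n - 2 *\<^sub>R u (n - 1) + u (n - 2)) \<longlonglongrightarrow> 0" unfolding \<delta>_def .
  have E_le: "E (n + 2) \<le> E 2" for n using decseqD[OF dec, of 0 n] unfolding add_0 by simp
  have Bseq_sqrt: "Bseq f" if "\<And>n. (norm (f (n + 2)))\<^sup>2 \<le> c" for f :: "nat \<Rightarrow> 'u" and c
  proof -
    have "Bseq (\<lambda>n. f (n + 2))"
      using that by (intro BseqI'[of _ "sqrt c"]) (simp add: real_le_rsqrt)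
    then show ?thesis by (rule Bseq_offset)
  qed
  show "Bseq v"
  proof (rule Bseq_sqrt)
    show "(norm (v (n + 2)))\<^sup>2 \<le> E 2" for n
      using E_ge[of "n + 2"] E_le[of n] M(3)
      by (smt (verit) divide_nonneg_pos mult_nonneg_nonneg zero_le_power2)
  qed
  show "Bseq u"
  proof (rule Bseq_sqrt)
    show "(norm (u (n + 2)))\<^sup>2 \<le> E 2 / (C\<^sub>1 / 2)" for n
    proof -
      have "C\<^sub>1 / 2 * (norm (u (n + 2)))\<^sup>2 \<le> E 2"
        using E_ge[of "n + 2"] E_le[of n] by (smt (verit) zero_le_power2)
      then show ?thesis using M(3) by (simp add: field_simps)
    qed
  qed
qed

section \<open>Multiplier bound and passage to the limit\<close>

text \<open>Taking \<open>lam n\<close> as competitor in the infimum gives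
  \<open>c \<le> C / norm (lam n)\<close>, with \<open>c\<close> and \<open>C\<close> independent of
  \<open>n\<close>.\<close>

lemma inf_sup_stable_imp_multiplier_bound:
  assumes stable: "inf_sup_stable B U\<^sub>0 u"
    and bound: "\<And>n w. n \<ge> 3 \<Longrightarrow> w \<in> U\<^sub>0 \<Longrightarrow>
      blinfun_apply (lam n) (B (extrapolation u n) w) \<le> C * norm w"
  obtains K where "\<And>n. n \<ge> 3 \<Longrightarrow> norm (lam n) \<le> K"
proof -
  obtain c where c: "c > 0" and inf: "\<And>n. n \<ge> 2 \<Longrightarrow>
      (INF \<mu>\<in>{\<mu>. \<mu> \<noteq> 0}. SUP w\<in>{w\<in>U\<^sub>0. w \<noteq> 0}.
        ereal (blinfun_apply \<mu> (B (extrapolation u n) w) / (norm w * norm \<mu>))) \<ge> ereal c"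
    using stable unfolding inf_sup_stable_def by blast
  \<comment> \<open>The \<open>max 0\<close> covers a vanishing multiplier, since the sign of
    \<open>C\<close> is not known.\<close>
  have "norm (lam n) \<le> max 0 (C / c)" if n: "n \<ge> 3" for n
  proof (cases "lam n = 0")
    case False
    then have pos: "norm (lam n) > 0" by simp
    have "ereal c \<le> (INF \<mu>\<in>{\<mu>. \<mu> \<noteq> 0}. SUP w\<in>{w\<in>U\<^sub>0. w \<noteq> 0}.
        ereal (blinfun_apply \<mu> (B (extrapolation u n) w) / (norm w * norm \<mu>)))"
      using inf n by simp
    also have "\<dots> \<le> (SUP w\<in>{w\<in>U\<^sub>0. w \<noteq> 0}.
        ereal (blinfun_apply (lam n) (B (extrapolation u n) w) / (norm w * norm (lam n))))"
      using False by (intro INF_lower) simp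
    also have "\<dots> \<le> ereal (C / norm (lam n))"
    proof (intro SUP_least)
      fix w assume "w \<in> {w\<in>U\<^sub>0. w \<noteq> 0}"
      then show "ereal (blinfun_apply (lam n) (B (extrapolation u n) w) / (norm w * norm (lam n)))
          \<le> ereal (C / norm (lam n))"
        using bound[OF n, of w] pos by (simp add: field_simps)
    qed
    finally have "norm (lam n) \<le> C / c" using c pos by (simp add: field_simps)
    then show ?thesis by simp
  qed simp
  then show thesis using that by blast
qed

theorem corollary4p6:
  fixes \<Omega> :: "(real^'d) set"
    and \<rho> :: "'u::{real_inner, complete_space} \<Rightarrow> real^'d \<Rightarrow> real^'m"
    and \<zeta> :: "'z::real_normed_vector \<Rightarrow> real^'d \<Rightarrow> 'b::euclidean_space"
    and \<Gamma>\<^sub>D :: "(real^'d) set"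
    and K :: "('m \<times> 'd list) set"
    and g :: "'m \<Rightarrow> 'd list \<Rightarrow> real^'d \<Rightarrow> real"
    and U\<^sub>D U\<^sub>0 :: "'u set"
    and B :: "'u \<Rightarrow> 'u \<Rightarrow> 'z" and u\<^sub>c :: 'z and c\<^sub>Z :: real
    and M :: "'u \<Rightarrow> 'u \<Rightarrow> real" and C\<^sub>1 C\<^sub>2 :: real
    and s \<alpha> :: real
    and u v :: "nat \<Rightarrow> 'u" and lam :: "nat \<Rightarrow> 'z \<Rightarrow>\<^sub>L real"
    and N :: "real \<Rightarrow> nat" and Tmax :: "real \<Rightarrow> real"
  defines "U\<^sub>D \<equiv> dirichlet_set \<Omega> \<rho> \<Gamma>\<^sub>D K g"
    and "U\<^sub>0 \<equiv> dirichlet_set \<Omega> \<rho> \<Gamma>\<^sub>D K (\<lambda>i \<beta> p. 0)"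
  assumes domain: "bounded_lipschitz_domain \<Omega>"
    and U: "continuously_embedded_in_h1 \<Omega> \<rho>"
    and Gamma: "\<Gamma>\<^sub>D \<subseteq> frontier \<Omega>"
    and Z: "function_space \<Omega> \<zeta>"
    and B: "bilinear B" "\<And>x y. B x y = B y x"
      "\<And>x. norm (B x x) \<le> c\<^sub>Z * (norm x)\<^sup>2"
    and M: "bilinear M" "\<And>x y. M x y = M y x"
      "C\<^sub>1 > 0" "\<And>x. M x x \<ge> C\<^sub>1 * (norm x)\<^sup>2"
      "C\<^sub>2 > 0" "\<And>x y. M x y \<le> C\<^sub>2 * norm x * norm y"
    and params: "s > 0" "\<alpha> \<ge> 3" "\<And>\<epsilon>. \<epsilon> > 0 \<Longrightarrow> Tmax \<epsilon> > 0"
    and run: "\<And>\<epsilon>. \<epsilon> > 0 \<Longrightarrow>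
      bdf2_run s \<alpha> M B U\<^sub>0 (admissible_set \<Omega> \<zeta> B u\<^sub>c U\<^sub>D) (tangent_space \<Omega> \<zeta> B U\<^sub>0)
        u v lam \<epsilon> (Tmax \<epsilon>) (N \<epsilon>)"
    and N: "filterlim N at_top (at_right 0)"
  shows "\<exists>u'. (\<exists>r. strict_mono r \<and> limitin weak_topology (u \<circ> r) u' sequentially) \<and>
     (inf_sup_stable B U\<^sub>0 u \<and>
      inj (bidual_map :: 'z \<Rightarrow> ('z \<Rightarrow>\<^sub>L real) \<Rightarrow>\<^sub>L real) \<and>
      (\<forall>w\<in>U\<^sub>0. weakly_continuous (\<lambda>x. B x w)) \<longrightarrow>
      (\<forall>w\<in>tangent_space \<Omega> \<zeta> B U\<^sub>0 u'. quadratic_energy M u' \<le> quadratic_energy M (u' + w)))"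
proof -
  \<comment> \<open>The runs for all tolerances share the same sequences, and \<open>N\<close>
    exceeds any given \<open>n\<close> for small \<epsilon>, so every step \<open>n \<ge> 3\<close>
    has been carried out.\<close>
  have saddle: "bdf2_saddle_step s \<alpha> M B U\<^sub>0 u v lam n" if n: "n \<ge> 3" for n
  proof -
    have "\<forall>\<^sub>F \<epsilon> in at_right 0. n \<le> N \<epsilon> \<and> 0 < \<epsilon>"
      using N[unfolded filterlim_at_top] eventually_at_right_less by (intro eventually_conj) auto
    then obtain \<epsilon> where "n \<le> N \<epsilon>" "\<epsilon> > 0"
      using eventually_happens trivial_limit_at_right_real by blast
    with run[of \<epsilon>] n show ?thesis unfolding bdf2_run_def by auto
  qed
  have "\<alpha> > 0" using params(2) by simp
  note asym = bdf2_asymptotics[OF M(1-4) params(1) this saddle]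
  \<comment> \<open>The upper bound on \<open>M\<close> is one-sided; replacing \<open>x\<close> by
    \<open>- x\<close> supplies the other side.\<close>
  have M_abs: "\<bar>M x y\<bar> \<le> C\<^sub>2 * norm x * norm y" for x y
    using M(6)[of x y] M(6)[of "- x" y] bilinear_lneg[OF M(1), of x y] by simp
  have M_blin: "bounded_linear (\<lambda>x. M x w)" for w
    by (rule bounded_linear_intro[of _ "C\<^sub>2 * norm w"])
      (use M_abs in \<open>auto simp: bilinear_ladd[OF M(1)] bilinear_lmul[OF M(1)] mult_ac\<close>)
  obtain Cu where Cu: "Cu > 0" "\<And>n. norm (u n) \<le> Cu" using asym(1) BseqE by blast
  obtain Cv where Cv: "Cv > 0" "\<And>n. norm (v n) \<le> Cv" using asym(2) BseqE by blast
  \<comment> \<open>The velocities are made small first; the weak limit is then extracted along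
    those indices, so both properties hold along \<open>r\<close>.\<close>
  obtain r\<^sub>1 where r1: "strict_mono r\<^sub>1" "((\<lambda>n. (norm (v n))\<^sup>2) \<circ> r\<^sub>1) \<longlonglongrightarrow> 0"
    using summable_harmonic_weight_imp_null_subsequence[OF _ asym(5)] by auto
  obtain r\<^sub>2 u' where r2: "strict_mono r\<^sub>2" "limitin weak_topology ((u \<circ> r\<^sub>1) \<circ> r\<^sub>2) u' sequentially"
    using bounded_imp_weakly_convergent_subsequence[of "u \<circ> r\<^sub>1" Cu] Cu(2) by auto
  define r where "r = r\<^sub>1 \<circ> r\<^sub>2"
  have r: "strict_mono r" using r1(1) r2(1) unfolding r_def by (rule strict_mono_o)
  have weak: "(\<lambda>k. f (u (r k))) \<longlonglongrightarrow> f u'" if "bounded_linear f" for f :: "'u \<Rightarrow> real"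
    using r2(2) that unfolding limitin_weak_topology_iff r_def by (simp add: comp_def)
  have "(\<lambda>k. (norm (v (r k)))\<^sup>2) \<longlonglongrightarrow> 0"
    using LIMSEQ_subseq_LIMSEQ[OF r1(2) r2(1)] unfolding r_def by (simp add: comp_def)
  from tendsto_real_sqrt[OF this] have v0: "(\<lambda>k. v (r k)) \<longlonglongrightarrow> 0"
    by (simp add: tendsto_norm_zero_iff)
  \<comment> \<open>The predecessor \<open>r k - 1\<close> need not be in the range of
    \<open>r\<close>, so smallness of \<open>v\<close> along \<open>r\<close> is not enough; the
    increments tend to zero along the full sequence.\<close>
  have dv0: "(\<lambda>k. dt s v (r k)) \<longlonglongrightarrow> 0"
    using tendsto_scaleR[OF tendsto_const LIMSEQ_subseq_LIMSEQ[OF asym(3) r], of "inverse s"]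
    by (simp add: dt_def comp_def)
  have r3: "\<forall>\<^sub>F k in sequentially. r k \<ge> 3"
    using eventually_ge_at_top[of 3] by eventually_elim (use seq_suble[OF r] le_trans in blast)
  have stationary: "M u' w = 0"
    if stable: "inf_sup_stable B U\<^sub>0 u"
      and cont: "\<forall>w\<in>U\<^sub>0. weakly_continuous (\<lambda>x. B x w)"
      and w: "w \<in> tangent_space \<Omega> \<zeta> B U\<^sub>0 u'" for w
  proof -
    have wU: "w \<in> U\<^sub>0" and "AE x in lebesgue_on \<Omega>. \<zeta> (B u' w) x = 0"
      using w unfolding tangent_space_def by auto
    \<comment> \<open>Elements of \<open>Z\<close> are classes of functions: a representative
      vanishing almost everywhere belongs to zero.\<close>
    then have Bw: "B u' w = 0" using Z unfolding function_space_def by blast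
    \<comment> \<open>The step equation solved for the multiplier term. It serves twice: to bound
      \<open>lam n\<close> through the inf-sup condition, and to identify the limit.\<close>
    have eq: "blinfun_apply (lam n) (B (extrapolation u n) y)
        = - (inner (dt s v n) y + \<alpha> / (real n * s) * inner (v n) y + M (u n) y)"
      if "n \<ge> 3" "y \<in> U\<^sub>0" for n y
    proof -
      have "u n = (1/3) *\<^sub>R (4 *\<^sub>R u (n - 1) - u (n - 2) + (2 * s) *\<^sub>R v n)"
        using saddle[OF that(1)] unfolding bdf2_saddle_step_def by blast
      then have "M (u n) y = 1/3 * M (4 *\<^sub>R u (n - 1) - u (n - 2) + (2 * s) *\<^sub>R v n) y"
        by (simp add: bilinear_lmul[OF M(1)])
      then show ?thesis
        using saddle[OF that(1)] that(2) unfolding bdf2_saddle_step_def by force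
    qed
    obtain K where K: "\<And>n. n \<ge> 3 \<Longrightarrow> norm (lam n) \<le> K"
    proof (rule inf_sup_stable_imp_multiplier_bound[OF stable])
      fix n y assume n: "n \<ge> (3::nat)" and y: "y \<in> U\<^sub>0"
      \<comment> \<open>The time-dependent friction coefficient is replaced by the uniform bound
        \<open>\<alpha> / s\<close>.\<close>
      have s1: "1 / (real n * s) \<le> 1 / s" using n params(1) by (simp add: field_simps)
      have "norm (dt s v n) \<le> (Cv + Cv) / s"
        using norm_triangle_ineq4[of "v n" "v (n - 1)"] Cv(2)[of n] Cv(2)[of "n - 1"] params(1)
        by (simp add: dt_def divide_inverse mult.commute)
      then have 1: "\<bar>inner (dt s v n) y\<bar> \<le> (Cv + Cv) / s * norm y"
        using Cauchy_Schwarz_ineq2 mult_right_mono order_trans norm_ge_zero by meson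
      have "\<bar>inner (v n) y\<bar> \<le> Cv * norm y"
        using Cauchy_Schwarz_ineq2 mult_right_mono[OF Cv(2)] order_trans norm_ge_zero by meson
      then have 2: "\<bar>\<alpha> / (real n * s) * inner (v n) y\<bar> \<le> \<alpha> / s * (Cv * norm y)"
        using s1 params mult_left_mono[OF s1, of \<alpha>] unfolding abs_mult
        by (intro mult_mono) auto
      have 3: "\<bar>M (u n) y\<bar> \<le> C\<^sub>2 * Cu * norm y"
        using M_abs[of "u n" y] mult_left_mono[OF Cu(2), of C\<^sub>2 n] M(5)
        by (meson less_imp_le mult_right_mono norm_ge_zero order_trans)
      show "blinfun_apply (lam n) (B (extrapolation u n) y)
          \<le> ((Cv + Cv) / s + \<alpha> / s * Cv + C\<^sub>2 * Cu) * norm y"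
        using 1 2 3 unfolding eq[OF n y] distrib_right mult.assoc by linarith
    qed blast
    \<comment> \<open>The extrapolated value is \<open>u n\<close> minus the second difference,
      which tends to zero in norm, so both sequences have the same weak limit.\<close>
    have "limitin weak_topology (\<lambda>k. extrapolation u (r k)) u' sequentially"
      unfolding limitin_weak_topology_iff
    proof (intro allI impI)
      fix f :: "'u \<Rightarrow> real" assume f: "bounded_linear f"
      then interpret f: bounded_linear f .
      have "(\<lambda>k. f (u (r k) - 2 *\<^sub>R u (r k - 1) + u (r k - 2))) \<longlonglongrightarrow> 0"
        using f.tendsto_zero[OF LIMSEQ_subseq_LIMSEQ[OF asym(4) r]] by (simp add: comp_def)
      from tendsto_diff[OF weak[OF f] this]
      show "(\<lambda>k. f (extrapolation u (r k))) \<longlonglongrightarrow> f u'"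
        unfolding extrapolation_def f.diff[symmetric] by (simp add: f.diff[symmetric] algebra_simps)
    qed
    then have "(\<lambda>k. B (extrapolation u (r k)) w) \<longlonglongrightarrow> 0"
      using cont wU Bw unfolding weakly_continuous_def by force
    then have Bnull: "(\<lambda>k. K * norm (B (extrapolation u (r k)) w)) \<longlonglongrightarrow> 0"
      using tendsto_mult_right_zero tendsto_norm_zero by blast
    \<comment> \<open>Weak continuity makes \<open>B (extrapolation u (r k)) w\<close> tend to
      \<open>B u' w = 0\<close> in norm, so bounded multipliers suffice; no limit of the multipliers
      themselves is taken.\<close>
    have lam0: "(\<lambda>k. blinfun_apply (lam (r k)) (B (extrapolation u (r k)) w)) \<longlonglongrightarrow> 0"
    proof (rule Lim_null_comparison[OF _ Bnull])
      show "\<forall>\<^sub>F k in sequentially. norm (blinfun_apply (lam (r k)) (B (extrapolation u (r k)) w))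
          \<le> K * norm (B (extrapolation u (r k)) w)"
        using r3 by eventually_elim
          (meson K mult_right_mono norm_blinfun norm_ge_zero order_trans)
    qed
    have coef: "(\<lambda>k. \<alpha> / (real (r k) * s)) \<longlonglongrightarrow> 0"
      using tendsto_mult_right_zero[OF LIMSEQ_subseq_LIMSEQ[OF lim_inverse_n r], of "\<alpha> / s"]
      by (simp add: comp_def field_simps)
    \<comment> \<open>Only the \<open>M\<close> term survives: the acceleration and friction terms
      vanish, and \<open>M\<close> with fixed second argument is a bounded functional, so it passes
      to the weak limit.\<close>
    have "(\<lambda>k. - (inner (dt s v (r k)) w + \<alpha> / (real (r k) * s) * inner (v (r k)) w
        + M (u (r k)) w)) \<longlonglongrightarrow> - (inner 0 w + 0 * inner 0 w + M u' w)"
      by (intro tendsto_intros dv0 v0 coef weak M_blin)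
    moreover have "\<forall>\<^sub>F k in sequentially. blinfun_apply (lam (r k)) (B (extrapolation u (r k)) w)
        = - (inner (dt s v (r k)) w + \<alpha> / (real (r k) * s) * inner (v (r k)) w + M (u (r k)) w)"
      using r3 by eventually_elim (rule eq[OF _ wU])
    ultimately have "(\<lambda>k. blinfun_apply (lam (r k)) (B (extrapolation u (r k)) w))
        \<longlonglongrightarrow> - (inner 0 w + 0 * inner 0 w + M u' w)"
      by (subst tendsto_cong)
    from LIMSEQ_unique[OF lam0 this] show ?thesis by simp
  qed
  have min: "quadratic_energy M u' \<le> quadratic_energy M (u' + w)" if "M u' w = 0" for w
  proof -
    have "M (u' + w) (u' + w) = M u' u' + M w w"
      using that M(2)[of w u'] by (simp add: bilinear_ladd[OF M(1)] bilinear_radd[OF M(1)])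
    moreover have "0 \<le> M w w"
      using M(3) M(4)[of w] by (smt (verit) mult_nonneg_nonneg zero_le_power2)
    ultimately show ?thesis unfolding quadratic_energy_def by simp
  qed
  have "limitin weak_topology (u \<circ> r) u' sequentially"
    using r2(2) unfolding r_def by (simp add: comp_assoc)
  with r stationary min show ?thesis by blast
qed

end
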